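(* Let $q$ be a prime power and let $n,k,r$ be integers with $1\le r\le k\le n-1$. Then $$\mathcal{C}_q(n,k,r)\le q^{n-k}\,\mathcal{C}_q(n-1,k-1,r-1)+\mathcal{C}_q(n-1,k,r).$$
   Context: $\mathcal{G}_q(n,k)$ denotes the set of all $k$-dimensional subspaces of $\mathbb{F}_q^n$. For $0\le r\le k\le n$, a $q$-covering design $C_q[n,k,r]$ is a set $\mathbb{S}\subseteq\mathcal{G}_q(n,k)$ such that each element of $\mathcal{G}_q(n,r)$ is contained in at least one element of $\mathbb{S}$. The $q$-covering number $\mathcal{C}_q(n,k,r)$ is the minimum size of a $q$-covering design $C_q[n,k,r]$. *)

theory Defs
  imports Complex_Main "HOL-Library.Function_Algebras" "HOL-Library.Cardinality"
begin

text \<open>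
  Vectors over a finite field are coordinate sequences of type \<open>nat \<Rightarrow> 'a\<close>, added pointwise.  A
  vector of length \<open>n\<close> is a sequence that vanishes from index \<open>n\<close> on, so that the spaces for
  different lengths live in one type and the length remains an ordinary natural number.
\<close>

definition vscale :: "'a::field \<Rightarrow> (nat \<Rightarrow> 'a) \<Rightarrow> nat \<Rightarrow> 'a" where
  "vscale c v = (\<lambda>i. c * v i)"

global_interpretation vec: vector_space vscale
  by unfold_locales (auto simp: vscale_def fun_eq_iff algebra_simps)

definition coord_space :: "nat \<Rightarrow> (nat \<Rightarrow> 'a::field) set" where
  "coord_space n = {v. \<forall>i\<ge>n. v i = 0}"

definition grassmannian :: "nat \<Rightarrow> nat \<Rightarrow> (nat \<Rightarrow> 'a::field) set set" where
  "grassmannian n k = {W. W \<subseteq> coord_space n \<and> vec.subspace W \<and> vec.dim W = k}"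

definition q_covering_design ::
  "nat \<Rightarrow> nat \<Rightarrow> nat \<Rightarrow> (nat \<Rightarrow> 'a::field) set set \<Rightarrow> bool" where
  "q_covering_design n k r S \<longleftrightarrow>
     S \<subseteq> grassmannian n k \<and> (\<forall>T\<in>grassmannian n r. \<exists>W\<in>S. T \<subseteq> W)"

text \<open>
  The prime power \<open>q\<close> enters through the field \<open>'a\<close>, of order \<open>q\<close>.  For \<open>r \<le> k \<le> n\<close> the
  minimum below is attained; see \<open>q_covering_number_attained\<close>.
\<close>

definition q_covering_number :: "'a::{field,finite} itself \<Rightarrow> nat \<Rightarrow> nat \<Rightarrow> nat \<Rightarrow> nat" where
  "q_covering_number F n k r =
     (LEAST m. \<exists>S :: (nat \<Rightarrow> 'a) set set. q_covering_design n k r S \<and> card S = m)"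

definition unit_seq :: "nat \<Rightarrow> nat \<Rightarrow> 'a::field" where
  "unit_seq j = (\<lambda>i. if i = j then 1 else 0)"

lemma subspace_coord_space: "vec.subspace (coord_space n)"
  by (auto simp: vec.subspace_def coord_space_def vscale_def)

lemma sum_seq_apply: "(\<Sum>j\<in>A. f j) i = (\<Sum>j\<in>A. f j i)"
  for f :: "'b \<Rightarrow> nat \<Rightarrow> 'a::comm_monoid_add"
  by (induction A rule: infinite_finite_induct) auto

lemma inj_unit_seq: "inj (unit_seq :: nat \<Rightarrow> nat \<Rightarrow> 'a::field)"
  by (auto simp: inj_def unit_seq_def fun_eq_iff split: if_splits)

lemma independent_unit_seq: "vec.independent (unit_seq ` {..<n} :: (nat \<Rightarrow> 'a::field) set)"
proof (rule vec.independent_if_scalars_zero)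
  fix f :: "(nat \<Rightarrow> 'a) \<Rightarrow> 'a" and x :: "nat \<Rightarrow> 'a"
  assume sum0: "(\<Sum>x\<in>unit_seq ` {..<n}. vscale (f x) x) = 0" and "x \<in> unit_seq ` {..<n}"
  then obtain j where j: "j < n" "x = unit_seq j" by auto
  have "(\<Sum>i<n. vscale (f (unit_seq i)) (unit_seq i)) = 0"
    using sum0 by (subst (asm) sum.reindex) (rule inj_on_subset[OF inj_unit_seq], simp, simp only: comp_def)
  then have "(\<Sum>i<n. vscale (f (unit_seq i)) (unit_seq i) j) = 0"
    using sum_seq_apply[of "\<lambda>i. vscale (f (unit_seq i)) (unit_seq i)" "{..<n}" j] by simp
  moreover have "(\<Sum>i<n. vscale (f (unit_seq i)) (unit_seq i) j)
      = (\<Sum>i<n. if i = j then f (unit_seq i) else 0)"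
    by (intro sum.cong) (auto simp: vscale_def unit_seq_def)
  ultimately show "f x = 0" using j by simp
qed simp

lemma span_unit_seq: "vec.span (unit_seq ` {..<n}) = (coord_space n :: (nat \<Rightarrow> 'a::field) set)"
proof
  show "vec.span (unit_seq ` {..<n}) \<subseteq> (coord_space n :: (nat \<Rightarrow> 'a) set)"
    by (rule vec.span_minimal[OF _ subspace_coord_space]) (auto simp: coord_space_def unit_seq_def)
  show "(coord_space n :: (nat \<Rightarrow> 'a) set) \<subseteq> vec.span (unit_seq ` {..<n})"
  proof
    fix v :: "nat \<Rightarrow> 'a" assume v: "v \<in> coord_space n"
    have "v = (\<Sum>i<n. vscale (v i) (unit_seq i))"
    proof
      fix j
      have "(\<Sum>i<n. vscale (v i) (unit_seq i)) j = (\<Sum>i<n. vscale (v i) (unit_seq i) j)"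
        by (rule sum_seq_apply)
      also have "\<dots> = (\<Sum>i<n. if i = j then v i else 0)"
        by (intro sum.cong) (auto simp: vscale_def unit_seq_def)
      also have "\<dots> = v j" using v by (auto simp: coord_space_def)
      finally show "v j = (\<Sum>i<n. vscale (v i) (unit_seq i)) j" ..
    qed
    also have "\<dots> \<in> vec.span (unit_seq ` {..<n})"
      by (intro vec.span_sum vec.span_scale vec.span_base) auto
    finally show "v \<in> vec.span (unit_seq ` {..<n})" .
  qed
qed

lemma dim_coord_space: "vec.dim (coord_space n :: (nat \<Rightarrow> 'a::field) set) = n"
proof -
  have "vec.dim (coord_space n :: (nat \<Rightarrow> 'a) set)
      = card (unit_seq ` {..<n} :: (nat \<Rightarrow> 'a) set)"
    using vec.dim_span[of "unit_seq ` {..<n} :: (nat \<Rightarrow> 'a) set"] vec.dim_eq_card_independent[OF independent_unit_seq[of n, where ?'a='a]] span_unit_seq[of n, where ?'a='a] by simp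
  then show ?thesis by (simp add: card_image inj_on_subset[OF inj_unit_seq])
qed

lemma finite_independent_coord_space:
  assumes "vec.independent B" "B \<subseteq> (coord_space n :: (nat \<Rightarrow> 'a::field) set)"
  shows "finite B"
  using vec.independent_span_bound[of "unit_seq ` {..<n}" B] assms
  by (simp add: span_unit_seq)

lemma q_covering_design_grassmannian:
  assumes "r \<le> k" "k \<le> n"
  shows "q_covering_design n k r (grassmannian n k :: (nat \<Rightarrow> 'a::field) set set)"
  unfolding q_covering_design_def
proof (intro conjI ballI subset_refl)
  fix T :: "(nat \<Rightarrow> 'a) set" assume "T \<in> grassmannian n r"
  then have T: "T \<subseteq> coord_space n" "vec.subspace T" "vec.dim T = r"
    by (auto simp: grassmannian_def)
  obtain B where B: "B \<subseteq> T" "vec.independent B" "T \<subseteq> vec.span B" "card B = r"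
    using vec.basis_exists[of T] T(3) by blast
  obtain C where C: "B \<subseteq> C" "C \<subseteq> coord_space n" "vec.independent C"
      "coord_space n \<subseteq> vec.span C"
    using vec.maximal_independent_subset_extend[of B "coord_space n"] B T(1) by blast
  have finC: "finite C" using C finite_independent_coord_space by blast
  have "card C = n" using vec.basis_card_eq_dim[OF C(2,4,3)] dim_coord_space[of n, where ?'a='a] by simp
  then obtain D where D: "B \<subseteq> D" "D \<subseteq> C" "card D = k"
    using exists_subset_between[of B k C] assms B(4) C(1) finC by auto
  have "vec.independent D" using C(3) D(2) vec.independent_mono by blast
  then have "vec.dim (vec.span D) = k" using D(3) by (simp add: vec.dim_eq_card_independent)
  moreover have "vec.span D \<subseteq> coord_space n"
    using D(2) C(2) vec.span_minimal[OF _ subspace_coord_space] by blast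
  ultimately have "vec.span D \<in> grassmannian n k" by (simp add: grassmannian_def)
  moreover have "T \<subseteq> vec.span D" using B(3) vec.span_mono[OF D(1)] by blast
  ultimately show "\<exists>W\<in>grassmannian n k. T \<subseteq> W" by blast
qed

lemma q_covering_number_attained:
  assumes "r \<le> k" "k \<le> n"
  shows "\<exists>S :: (nat \<Rightarrow> 'a::{field,finite}) set set.
    q_covering_design n k r S \<and> card S = q_covering_number TYPE('a) n k r"
  unfolding q_covering_number_def
  by (rule LeastI_ex) (use q_covering_design_grassmannian[OF assms, where ?'a='a] in blast)

lemma finite_coord_space: "finite (coord_space n :: (nat \<Rightarrow> 'a::{field,finite}) set)"
proof -
  have inj: "inj_on (\<lambda>v. map v [0..<n]) (coord_space n :: (nat \<Rightarrow> 'a) set)"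
  proof (rule inj_onI, rule ext)
    fix v w :: "nat \<Rightarrow> 'a" and i
    assume "v \<in> coord_space n" "w \<in> coord_space n" "map v [0..<n] = map w [0..<n]"
    then show "v i = w i" by (cases "i < n") (auto simp: coord_space_def)
  qed
  have "(\<lambda>v. map v [0..<n]) ` (coord_space n :: (nat \<Rightarrow> 'a) set)
      \<subseteq> {xs. set xs \<subseteq> UNIV \<and> length xs = n}"
    by auto
  then have "finite ((\<lambda>v. map v [0..<n]) ` (coord_space n :: (nat \<Rightarrow> 'a) set))"
    by (rule finite_subset) (rule finite_lists_length_eq, rule finite)
  with inj show ?thesis by (rule finite_imageD[rotated])
qed

lemma finite_grassmannian: "finite (grassmannian n k :: (nat \<Rightarrow> 'a::{field,finite}) set set)"
  by (rule finite_subset[of _ "Pow (coord_space n)"])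
    (auto simp: grassmannian_def finite_coord_space)

end

theory Submission
  imports Defs "HOL-Library.FuncSet"
begin

text \<open>
  Let \<open>H\<close> be the hyperplane \<open>coord_space m\<close> of \<open>coord_space (Suc m)\<close> and let \<open>e\<close> be the last unit
  vector.  An \<open>r\<close>-dimensional subspace \<open>T\<close> of the large space has one of two positions.  If
  \<open>T \<subseteq> H\<close>, a member of an optimal design for the parameters \<open>m, k, r\<close> contains \<open>T\<close>.  Otherwise
  \<open>T \<inter> H\<close> has dimension \<open>r - 1\<close>, so some \<open>U\<close> of an optimal design for \<open>m, k - 1, r - 1\<close> contains
  \<open>T \<inter> H\<close>, and \<open>T\<close> lies in the \<open>k\<close>-dimensional space spanned by \<open>U\<close> and any vector
  of \<open>T\<close> outside \<open>H\<close>.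

  It is therefore enough to take, for every such \<open>U\<close>, all \<open>k\<close>-dimensional spaces through \<open>U\<close> that
  are not contained in \<open>H\<close>.  After scaling, the vector outside \<open>H\<close> is \<open>e + h\<close> with \<open>h \<in> H\<close>, and the
  space depends on \<open>h\<close> only modulo \<open>U\<close>.  Hence there are at most
  \<open>card (H / U) = q ^ (m - (k - 1)) = q ^ (n - k)\<close> of them, where \<open>n = Suc m\<close>.  The lemma
  \<open>coset_representatives\<close> supplies this count, and \<open>dim_span_insert\<close> all the dimensions.
\<close>

lemma dim_span_insert:
  fixes U :: "(nat \<Rightarrow> 'a::field) set"
  assumes U: "vec.subspace U" "U \<subseteq> coord_space n" and v: "v \<notin> U"
  shows "vec.dim (vec.span (insert v U)) = Suc (vec.dim U)"
proof -
  obtain B where B: "B \<subseteq> U" "vec.independent B" "U \<subseteq> vec.span B" "card B = vec.dim U"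
    using vec.basis_exists[of U] by blast
  have span_B: "vec.span B = U"
    using B U(1) vec.span_minimal by blast
  have fin: "finite B"
    using finite_independent_coord_space[OF B(2)] B(1) U(2) by blast
  have ind: "vec.independent (insert v B)"
    using B(2) v span_B by (simp add: vec.independent_insert)
  have "vec.span (insert v U) = vec.span (insert v B)"
    unfolding vec.span_insert span_B[symmetric] vec.span_span ..
  moreover have "card (insert v B) = Suc (vec.dim U)"
    using fin v B(1,4) by (subst card_insert_disjoint) auto
  ultimately show ?thesis
    using vec.dim_eq_card_independent[OF ind] by simp
qed

lemma card_span_le:
  fixes B :: "(nat \<Rightarrow> 'a::{field,finite}) set"
  assumes "finite B"
  shows "finite (vec.span B) \<and> card (vec.span B) \<le> CARD('a) ^ card B"
proof -
  let ?F = "PiE B (\<lambda>_. UNIV :: 'a set)" and ?g = "\<lambda>f. \<Sum>b\<in>B. vscale (f b) b"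
  have "vec.span B \<subseteq> ?g ` ?F"
  proof
    fix x assume "x \<in> vec.span B"
    then obtain f where "x = ?g f" using vec.span_finite[OF assms] by auto
    then show "x \<in> ?g ` ?F" by (intro image_eqI[of _ _ "restrict f B"]) simp_all
  qed
  moreover have "finite ?F" using assms by (simp add: finite_PiE)
  moreover have "card ?F = CARD('a) ^ card B" using assms by (simp add: card_PiE)
  ultimately show ?thesis
    using surj_card_le[of ?F "vec.span B" ?g] finite_surj[of ?F "vec.span B" ?g] by metis
qed

text \<open>
  A complement of \<open>U\<close>, spanned by the vectors that extend a basis of \<open>U\<close> to one of the whole
  space, meets every coset of \<open>U\<close>.
\<close>

lemma coset_representatives:
  fixes U :: "(nat \<Rightarrow> 'a::{field,finite}) set"
  assumes "U \<in> grassmannian m j"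
  obtains D where "D \<subseteq> coord_space m" "finite D" "card D \<le> CARD('a) ^ (m - j)"
    "\<And>x. x \<in> coord_space m \<Longrightarrow> \<exists>d\<in>D. x - d \<in> U"
proof -
  have U: "U \<subseteq> coord_space m" "vec.subspace U" "vec.dim U = j"
    using assms by (auto simp: grassmannian_def)
  obtain B where B: "B \<subseteq> U" "vec.independent B" "U \<subseteq> vec.span B" "card B = j"
    using vec.basis_exists[of U] U(3) by blast
  obtain C where C: "B \<subseteq> C" "C \<subseteq> coord_space m" "vec.independent C"
      "coord_space m \<subseteq> vec.span C"
    using vec.maximal_independent_subset_extend[of B "coord_space m"] B U(1) by blast
  have finC: "finite C" using C finite_independent_coord_space by blast
  have "card C = m"
    using vec.basis_card_eq_dim[OF C(2,4,3)] dim_coord_space[of m, where ?'a='a] by simp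
  then have card_diff: "card (C - B) = m - j"
    using card_Diff_subset[of B C] finC C(1) B(4) finite_subset by metis
  show thesis
  proof (rule that[of "vec.span (C - B)"])
    show "vec.span (C - B) \<subseteq> coord_space m"
      using C(2) by (intro vec.span_minimal subspace_coord_space) auto
    show "finite (vec.span (C - B))" "card (vec.span (C - B)) \<le> CARD('a) ^ (m - j)"
      using card_span_le[of "C - B"] finC card_diff by auto
    fix x :: "nat \<Rightarrow> 'a" assume "x \<in> coord_space m"
    then have "x \<in> vec.span (B \<union> (C - B))" using C(1,4) by (auto simp: Un_absorb1)
    then obtain u d where "x = u + d" "u \<in> vec.span B" "d \<in> vec.span (C - B)"
      unfolding vec.span_Un by blast
    moreover have "vec.span B \<subseteq> U" using B(1) U(2) vec.span_minimal by blast
    ultimately show "\<exists>d\<in>vec.span (C - B). x - d \<in> U" by (auto intro!: bexI[of _ d])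
  qed
qed

lemma coord_space_mono: "m \<le> n \<Longrightarrow> coord_space m \<subseteq> coord_space n"
  by (auto simp: coord_space_def)

lemma last_coordinate_nonzero:
  assumes "v \<in> coord_space (Suc m)" "v \<notin> coord_space m"
  shows "v m \<noteq> 0"
proof
  assume "v m = 0"
  then have "v i = 0" if "m \<le> i" for i
    using assms(1) that by (cases "i = m") (auto simp: coord_space_def)
  then show False using assms(2) by (simp add: coord_space_def)
qed

text \<open>
  On \<open>coord_space (Suc m)\<close> the last coordinate is a linear functional with kernel
  \<open>coord_space m\<close>, and it does not vanish at \<open>v\<close>.  Subtracting a suitable multiple of \<open>v\<close>
  therefore moves each vector of \<open>T\<close> into the hyperplane section.
\<close>

lemma span_insert_hyperplane_section:
  fixes T :: "(nat \<Rightarrow> 'a::field) set"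
  assumes T: "T \<subseteq> coord_space (Suc m)" "vec.subspace T" and v: "v \<in> T" "v \<notin> coord_space m"
  shows "vec.span (insert v (T \<inter> coord_space m)) = T"
proof
  show "vec.span (insert v (T \<inter> coord_space m)) \<subseteq> T"
    using v T(2) by (intro vec.span_minimal) auto
  have vm: "v m \<noteq> 0"
    using last_coordinate_nonzero v T(1) by blast
  show "T \<subseteq> vec.span (insert v (T \<inter> coord_space m))"
  proof
    fix t assume t: "t \<in> T"
    let ?w = "t - vscale (t m / v m) v"
    have "?w \<in> T"
      using t v T(2) by (intro vec.subspace_diff vec.subspace_scale)
    moreover have "?w \<in> coord_space m"
      unfolding coord_space_def
    proof (intro CollectI allI impI)
      fix i assume "m \<le> i"
      then consider "i = m" | "Suc m \<le> i" by linarith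
      then show "?w i = 0"
      proof cases
        case 1 then show ?thesis using vm by (simp add: vscale_def)
      next
        case 2
        then have "t i = 0" "v i = 0" using t v T(1) by (auto simp: coord_space_def)
        then show ?thesis by (simp add: vscale_def)
      qed
    qed
    ultimately show "t \<in> vec.span (insert v (T \<inter> coord_space m))"
      unfolding vec.span_breakdown_eq by (auto intro: vec.span_base)
  qed
qed

text \<open>
  The spaces \<open>span (insert (e + d) U)\<close>, with \<open>d\<close> running through representatives of the cosets of
  \<open>U\<close> in the hyperplane, are all the spaces \<open>span (insert v U)\<close> with \<open>v\<close> outside the hyperplane.
\<close>

lemma hyperplane_lifts:
  fixes U :: "(nat \<Rightarrow> 'a::{field,finite}) set"
  assumes "U \<in> grassmannian m j"
  obtains L where "L \<subseteq> grassmannian (Suc m) (Suc j)" "card L \<le> CARD('a) ^ (m - j)"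
    "\<And>v. \<lbrakk>v \<in> coord_space (Suc m); v \<notin> coord_space m\<rbrakk> \<Longrightarrow> \<exists>W\<in>L. insert v U \<subseteq> W"
proof -
  have U: "U \<subseteq> coord_space m" "vec.subspace U" "vec.dim U = j"
    using assms by (auto simp: grassmannian_def)
  have U': "U \<subseteq> coord_space (Suc m)"
    using U(1) coord_space_mono[of m "Suc m", where ?'a='a] by auto
  obtain D where D: "D \<subseteq> coord_space m" "finite D" "card D \<le> CARD('a) ^ (m - j)"
    "\<And>x. x \<in> coord_space m \<Longrightarrow> \<exists>d\<in>D. x - d \<in> U"
    using coset_representatives[OF assms] by blast
  define lift where "lift d = vec.span (insert (unit_seq m + d) U)" for d
  show thesis
  proof (rule that[of "lift ` D"])
    show "card (lift ` D) \<le> CARD('a) ^ (m - j)"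
      using card_image_le[OF D(2), of lift] D(3) by linarith
    show "lift ` D \<subseteq> grassmannian (Suc m) (Suc j)"
    proof (rule image_subsetI)
      fix d assume "d \<in> D"
      then have d: "d \<in> coord_space m" using D(1) by blast
      have "(unit_seq m + d) m = 1" using d by (simp add: unit_seq_def coord_space_def)
      then have "unit_seq m + d \<notin> U" using U(1) by (auto simp: coord_space_def)
      then have "vec.dim (lift d) = Suc j"
        using dim_span_insert[OF U(2,1)] U(3) by (simp add: lift_def)
      moreover have "lift d \<subseteq> coord_space (Suc m)"
        unfolding lift_def using d U'
        by (intro vec.span_minimal subspace_coord_space) (auto simp: coord_space_def unit_seq_def)
      ultimately show "lift d \<in> grassmannian (Suc m) (Suc j)"
        by (simp add: grassmannian_def lift_def)
    qed
    fix v :: "nat \<Rightarrow> 'a" assume v: "v \<in> coord_space (Suc m)" "v \<notin> coord_space m"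
    define c where "c = v m"
    \<comment> \<open>Scaling \<open>v\<close> to last coordinate \<open>1\<close> leaves a component \<open>h\<close> in the hyperplane.\<close>
    define h where "h = vscale (inverse c) v - unit_seq m"
    have c: "c \<noteq> 0"
      unfolding c_def by (rule last_coordinate_nonzero[OF v])
    have "h \<in> coord_space m"
      unfolding coord_space_def
    proof (intro CollectI allI impI)
      fix i assume "m \<le> i"
      then show "h i = 0"
        using c v(1) by (cases "i = m") (auto simp: h_def c_def unit_seq_def vscale_def coord_space_def)
    qed
    then obtain d where d: "d \<in> D" "h - d \<in> U" using D(4) by blast
    have "v = vscale c ((unit_seq m + d) + (h - d))"
      using c by (auto simp: h_def vscale_def fun_eq_iff field_simps)
    also have "\<dots> \<in> lift d"
      unfolding lift_def using d(2) by (intro vec.span_scale vec.span_add vec.span_base) auto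
    finally have "insert v U \<subseteq> lift d"
      by (auto simp: lift_def intro: vec.span_base)
    then show "\<exists>W\<in>lift ` D. insert v U \<subseteq> W" using d(1) by blast
  qed
qed

lemma q_covering_number_le_card:
  "q_covering_design n k r S \<Longrightarrow> q_covering_number TYPE('a) n k r \<le> card S"
  for S :: "(nat \<Rightarrow> 'a::{field,finite}) set set"
  unfolding q_covering_number_def by (rule Least_le) blast

lemma q_covering_number_Suc_le:
  assumes "s \<le> j" "Suc j \<le> m"
  shows "q_covering_number TYPE('a::{field,finite}) (Suc m) (Suc j) (Suc s)
    \<le> CARD('a) ^ (m - j) * q_covering_number TYPE('a) m j s
        + q_covering_number TYPE('a) m (Suc j) (Suc s)"
proof -
  obtain A :: "(nat \<Rightarrow> 'a) set set"
    where A: "q_covering_design m j s A" "card A = q_covering_number TYPE('a) m j s"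
    using q_covering_number_attained[of s j m, where ?'a='a] assms by auto
  obtain B :: "(nat \<Rightarrow> 'a) set set" where B: "q_covering_design m (Suc j) (Suc s) B"
      "card B = q_covering_number TYPE('a) m (Suc j) (Suc s)"
    using q_covering_number_attained[of "Suc s" "Suc j" m, where ?'a='a] assms by auto
  have A_sub: "A \<subseteq> grassmannian m j" using A(1) by (simp add: q_covering_design_def)
  then have finA: "finite A" using finite_grassmannian finite_subset by blast
  have "\<forall>U\<in>A. \<exists>L. L \<subseteq> grassmannian (Suc m) (Suc j) \<and> card L \<le> CARD('a) ^ (m - j) \<and>
      (\<forall>v. v \<in> coord_space (Suc m) \<longrightarrow> v \<notin> coord_space m \<longrightarrow> (\<exists>W\<in>L. insert v U \<subseteq> W))"
    (is "\<forall>U\<in>A. ?lifts U")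
  proof
    fix U assume "U \<in> A"
    then have "U \<in> grassmannian m j" using A_sub by blast
    then show "?lifts U" by (rule hyperplane_lifts) blast
  qed
  then obtain L where L: "\<And>U. U \<in> A \<Longrightarrow> L U \<subseteq> grassmannian (Suc m) (Suc j)"
      "\<And>U. U \<in> A \<Longrightarrow> card (L U) \<le> CARD('a) ^ (m - j)"
      "\<And>U v. \<lbrakk>U \<in> A; v \<in> coord_space (Suc m); v \<notin> coord_space m\<rbrakk> \<Longrightarrow> \<exists>W\<in>L U. insert v U \<subseteq> W"
    by metis
  let ?S = "(\<Union>U\<in>A. L U) \<union> B"
  have "q_covering_design (Suc m) (Suc j) (Suc s) ?S"
    unfolding q_covering_design_def
  proof (intro conjI ballI)
    have "B \<subseteq> grassmannian (Suc m) (Suc j)"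
      using B(1) coord_space_mono[of m "Suc m", where ?'a='a]
      by (auto simp: q_covering_design_def grassmannian_def)
    then show "?S \<subseteq> grassmannian (Suc m) (Suc j)" using L(1) by blast
  next
    fix T :: "(nat \<Rightarrow> 'a) set" assume "T \<in> grassmannian (Suc m) (Suc s)"
    then have T: "T \<subseteq> coord_space (Suc m)" "vec.subspace T" "vec.dim T = Suc s"
      by (auto simp: grassmannian_def)
    show "\<exists>W\<in>?S. T \<subseteq> W"
    proof (cases "T \<subseteq> coord_space m")
      case True
      then have "T \<in> grassmannian m (Suc s)" using T by (simp add: grassmannian_def)
      then show ?thesis using B(1) unfolding q_covering_design_def by blast
    next
      case False
      then obtain v where v: "v \<in> T" "v \<notin> coord_space m" by blast
      let ?H = "T \<inter> coord_space m"
      have T_eq: "vec.span (insert v ?H) = T"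
        by (rule span_insert_hyperplane_section[OF T(1,2) v])
      have sub_H: "vec.subspace ?H"
        by (intro vec.subspace_inter T(2) subspace_coord_space)
      have "vec.dim ?H = s"
        using dim_span_insert[OF sub_H, of m v] v(2) T(3) unfolding T_eq by simp
      then have "?H \<in> grassmannian m s" using sub_H by (simp add: grassmannian_def)
      then obtain U where U: "U \<in> A" "?H \<subseteq> U"
        using A(1) unfolding q_covering_design_def by blast
      obtain W where W: "W \<in> L U" "insert v U \<subseteq> W"
        using L(3)[OF U(1), of v] v T(1) by blast
      have "vec.subspace W" using L(1)[OF U(1)] W(1) by (auto simp: grassmannian_def)
      then have "T \<subseteq> W"
        using U(2) W(2) vec.span_minimal[of "insert v ?H" W] unfolding T_eq by blast
      then show ?thesis using U(1) W(1) by blast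
    qed
  qed
  then have "q_covering_number TYPE('a) (Suc m) (Suc j) (Suc s) \<le> card ?S"
    by (rule q_covering_number_le_card)
  also have "\<dots> \<le> card (\<Union>U\<in>A. L U) + card B" by (rule card_Un_le)
  also have "card (\<Union>U\<in>A. L U) \<le> (\<Sum>U\<in>A. card (L U))" by (rule card_UN_le[OF finA])
  also have "\<dots> \<le> CARD('a) ^ (m - j) * card A"
    using sum_bounded_above[of A "\<lambda>U. card (L U)", OF L(2)] by (simp add: mult.commute)
  finally show ?thesis by (simp add: A(2) B(2))
qed

theorem theorem10:
  fixes q n k r :: nat
  assumes "CARD('a::{field,finite}) = q"
    and "1 \<le> r" and "r \<le> k" and "k \<le> n - 1"
  shows "q_covering_number TYPE('a) n k r
    \<le> q ^ (n - k) * q_covering_number TYPE('a) (n - 1) (k - 1) (r - 1)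
        + q_covering_number TYPE('a) (n - 1) k r"
proof -
  have "Suc (r - 1) = r" "Suc (k - 1) = k" "Suc (n - 1) = n" "n - 1 - (k - 1) = n - k"
    using assms(2-4) by auto
  then show ?thesis
    using q_covering_number_Suc_le[of "r - 1" "k - 1" "n - 1", where ?'a='a] assms by simp
qed

end
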